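(* Let $\widetilde a$ be a unitary transition amplitude on $\mathcal P$ with coupling constants $c_{n,j}^k$, and let $U_n\colon H_n\to H_{n+1}$, $n\ge 1$, be the linear operator determined by $U_n\widehat x_{n,j}=\sum_{k=0}^3 c_{n,j}^k\,\widehat x_{n+1,4j+k}$ for $j=0,1,\ldots,4^{n-1}-1$. Then for every $n\ge1$: (i) If $\rho$ is a state on $H_n$, then $U_n\rho U_n^*$ is a state on $H_{n+1}$. (ii) If $\rho$ is a stochastic state on $H_n$, then $U_n\rho U_n^*$ is a stochastic state on $H_{n+1}$.
   Context: For $n=1,2,\ldots$ let $\mathcal P_n=\{x_{n,0},x_{n,1},\ldots,x_{n,4^{n-1}-1}\}$ be a set of $4^{n-1}$ distinct elements, the $\mathcal P_n$ being pairwise disjoint, and let $\mathcal P=\bigcup_n\mathcal P_n$. (In the source, $\mathcal P_n$ is the set of covariant finite posets of cardinality $2n-1$, suitably ordered; only the tree structure matters here.) Write $x\to y$ ("$y$ is an offspring of $x$") if and only if $x=x_{n,j}$ and $y=x_{n+1,4j+k}$ for some $n\ge1$, $0\le j\le 4^{n-1}-1$, $k\in\{0,1,2,3\}$. A unitary transition amplitude is a map $\widetilde a\colon\mathcal P\times\mathcal P\to\mathbb C$ with $\widetilde a(x,y)=0$ if $x\not\to y$, and $\sum_{y\in\mathcal P}\widetilde a(x,y)=1$ and $\sum_{y\in\mathcal P}|\widetilde a(x,y)|^2=1$ for every $x\in\mathcal P$. Its coupling constants are $c_{n,j}^k=\widetilde a(x_{n,j},x_{n+1,4j+k})$, $k=0,1,2,3$;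 hence $\sum_{k=0}^3c_{n,j}^k=\sum_{k=0}^3|c_{n,j}^k|^2=1$. $H_n$ is the Hilbert space of all functions $f\colon\mathcal P_n\to\mathbb C$ with inner product $\langle f,g\rangle=\sum_{x\in\mathcal P_n}\overline{f(x)}g(x)$, and $\widehat x_{n,j}\in H_n$ is the characteristic function of $\{x_{n,j}\}$. $1_n\in H_n$ is the constant function with value $1$ on $\mathcal P_n$. A state on $H_n$ is a positive (semidefinite) operator $\rho$ on $H_n$ with $\mathrm{tr}(\rho)=1$. A stochastic state on $H_n$ is a state $\rho$ satisfying $\langle\rho 1_n,1_n\rangle=1$. *)

theory Defs
  imports "HOL-Analysis.Analysis"
begin

section \<open>The tree of posets\<close>

text \<open>The elements are given by a labelling \<open>x\<close>, where \<open>x n j\<close> is \<open>x\<^sub>n\<^sub>,\<^sub>j\<close>; only the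
  indices \<open>n \<ge> 1\<close>, \<open>j < 4 ^ (n - 1)\<close> are meaningful. Injectivity on these indices says both that
  each level has \<open>4 ^ (n - 1)\<close> distinct elements and that different levels are disjoint.\<close>

definition poset_labelling :: "(nat \<Rightarrow> nat \<Rightarrow> 'p) \<Rightarrow> bool" where
  "poset_labelling x \<longleftrightarrow> inj_on (\<lambda>(n, j). x n j) (SIGMA n:{1..}. {..<4 ^ (n - 1)})"

definition level :: "(nat \<Rightarrow> nat \<Rightarrow> 'p) \<Rightarrow> nat \<Rightarrow> 'p set" where
  "level x n = x n ` {..<4 ^ (n - 1)}"

definition all_posets :: "(nat \<Rightarrow> nat \<Rightarrow> 'p) \<Rightarrow> 'p set" where
  "all_posets x = (\<Union>n\<in>{1..}. level x n)"

definition offspring :: "(nat \<Rightarrow> nat \<Rightarrow> 'p) \<Rightarrow> 'p \<Rightarrow> 'p \<Rightarrow> bool" where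
  "offspring x u v \<longleftrightarrow>
     (\<exists>n j k. n \<ge> 1 \<and> j < 4 ^ (n - 1) \<and> k < 4 \<and> u = x n j \<and> v = x (n + 1) (4 * j + k))"

definition unitary_transition_amplitude ::
    "(nat \<Rightarrow> nat \<Rightarrow> 'p) \<Rightarrow> ('p \<Rightarrow> 'p \<Rightarrow> complex) \<Rightarrow> bool" where
  "unitary_transition_amplitude x a \<longleftrightarrow>
     (\<forall>u\<in>all_posets x. \<forall>v\<in>all_posets x. \<not> offspring x u v \<longrightarrow> a u v = 0) \<and>
     (\<forall>u\<in>all_posets x. ((\<lambda>v. a u v) has_sum 1) (all_posets x)) \<and>
     (\<forall>u\<in>all_posets x. ((\<lambda>v. (cmod (a u v))\<^sup>2) has_sum 1) (all_posets x))"

definition coupling_constant ::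
    "(nat \<Rightarrow> nat \<Rightarrow> 'p) \<Rightarrow> ('p \<Rightarrow> 'p \<Rightarrow> complex) \<Rightarrow> nat \<Rightarrow> nat \<Rightarrow> nat \<Rightarrow> complex" where
  "coupling_constant x a n j k = a (x n j) (x (n + 1) (4 * j + k))"


section \<open>Operators on the Hilbert space of functions on a finite set\<close>

text \<open>A function \<open>S \<rightarrow> \<complex>\<close> is represented by its extension by zero. With this convention the
  characteristic function of \<open>{u}\<close> is \<open>indicator {u}\<close>, the constant function \<open>1\<close> on \<open>S\<close> is
  \<open>indicator S\<close>, and the vector space operations are the pointwise ones. Operators are only
  considered on such functions; their values elsewhere are irrelevant.\<close>

definition fun_space :: "'p set \<Rightarrow> ('p \<Rightarrow> complex) set" where
  "fun_space S = {f. \<forall>u. u \<notin> S \<longrightarrow> f u = 0}"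

definition cinner_on :: "'p set \<Rightarrow> ('p \<Rightarrow> complex) \<Rightarrow> ('p \<Rightarrow> complex) \<Rightarrow> complex" where
  "cinner_on S f g = (\<Sum>u\<in>S. cnj (f u) * g u)"

definition linear_op ::
    "'p set \<Rightarrow> 'q set \<Rightarrow> (('p \<Rightarrow> complex) \<Rightarrow> ('q \<Rightarrow> complex)) \<Rightarrow> bool" where
  "linear_op S T A \<longleftrightarrow>
     (\<forall>f\<in>fun_space S. A f \<in> fun_space T) \<and>
     (\<forall>f\<in>fun_space S. \<forall>g\<in>fun_space S. A (\<lambda>u. f u + g u) = (\<lambda>v. A f v + A g v)) \<and>
     (\<forall>c. \<forall>f\<in>fun_space S. A (\<lambda>u. c * f u) = (\<lambda>v. c * A f v))"

definition is_adjoint_on :: "'p set \<Rightarrow> 'q set \<Rightarrow> (('p \<Rightarrow> complex) \<Rightarrow> ('q \<Rightarrow> complex)) \<Rightarrow>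
    (('q \<Rightarrow> complex) \<Rightarrow> ('p \<Rightarrow> complex)) \<Rightarrow> bool" where
  "is_adjoint_on S T A B \<longleftrightarrow> linear_op T S B \<and>
     (\<forall>f\<in>fun_space S. \<forall>g\<in>fun_space T. cinner_on T (A f) g = cinner_on S f (B g))"

text \<open>For finite sets and linear \<open>A\<close> the adjoint exists and is determined on \<open>fun_space T\<close>;
  see \<open>is_adjoint_on_adjoint_on\<close> and \<open>is_adjoint_on_unique\<close> below.\<close>

definition adjoint_on :: "'p set \<Rightarrow> 'q set \<Rightarrow> (('p \<Rightarrow> complex) \<Rightarrow> ('q \<Rightarrow> complex)) \<Rightarrow>
    (('q \<Rightarrow> complex) \<Rightarrow> ('p \<Rightarrow> complex))" where
  "adjoint_on S T A = (SOME B. is_adjoint_on S T A B)"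

definition positive_op :: "'p set \<Rightarrow> (('p \<Rightarrow> complex) \<Rightarrow> ('p \<Rightarrow> complex)) \<Rightarrow> bool" where
  "positive_op S A \<longleftrightarrow> linear_op S S A \<and>
     (\<forall>f\<in>fun_space S. cinner_on S f (A f) \<in> \<real> \<and> 0 \<le> Re (cinner_on S f (A f)))"

definition trace_op :: "'p set \<Rightarrow> (('p \<Rightarrow> complex) \<Rightarrow> ('p \<Rightarrow> complex)) \<Rightarrow> complex" where
  "trace_op S A = (\<Sum>u\<in>S. cinner_on S (indicator {u}) (A (indicator {u})))"

definition state_on :: "'p set \<Rightarrow> (('p \<Rightarrow> complex) \<Rightarrow> ('p \<Rightarrow> complex)) \<Rightarrow> bool" where
  "state_on S \<rho> \<longleftrightarrow> positive_op S \<rho> \<and> trace_op S \<rho> = 1"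

definition stochastic_state_on :: "'p set \<Rightarrow> (('p \<Rightarrow> complex) \<Rightarrow> ('p \<Rightarrow> complex)) \<Rightarrow> bool" where
  "stochastic_state_on S \<rho> \<longleftrightarrow>
     state_on S \<rho> \<and> cinner_on S (\<rho> (indicator S)) (indicator S) = 1"


section \<open>Existence and uniqueness of the adjoint\<close>

lemma indicator_in_fun_space: "u \<in> S \<Longrightarrow> indicator {u} \<in> fun_space S"
  by (auto simp: fun_space_def indicator_def)

lemma cinner_on_indicator:
  assumes "finite S" "u \<in> S"
  shows "cinner_on S (indicator {u}) g = g u"
proof -
  have "cinner_on S (indicator {u}) g = (\<Sum>v\<in>S. if v = u then g v else 0)"
    unfolding cinner_on_def by (rule sum.cong) (auto simp: indicator_def)
  then show ?thesis using assms by simp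
qed

lemma linear_op_expansion_aux:
  assumes A: "linear_op S T A" and "finite F" "F \<subseteq> S"
  shows "A (\<lambda>u. \<Sum>w\<in>F. f w * indicator {w} u) = (\<lambda>v. \<Sum>w\<in>F. f w * A (indicator {w}) v)"
  using assms(2,3)
proof (induction F rule: finite_induct)
  case empty
  have 0: "(\<lambda>_. 0) \<in> fun_space S" by (simp add: fun_space_def)
  have "\<forall>c. \<forall>f\<in>fun_space S. A (\<lambda>u. c * f u) = (\<lambda>v. c * A f v)"
    using A by (simp add: linear_op_def)
  from bspec[OF spec[OF this, of 0] 0] show ?case by simp
next
  case (insert w F)
  have w: "indicator {w} \<in> fun_space S" using insert.prems by (simp add: indicator_in_fun_space)
  have sc: "A (\<lambda>u. f w * indicator {w} u) = (\<lambda>v. f w * A (indicator {w}) v)"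
    using A w unfolding linear_op_def by blast
  have s1: "(\<lambda>u. f w * indicator {w} u) \<in> fun_space S"
    using w by (simp add: fun_space_def)
  have s2: "(\<lambda>u. \<Sum>w\<in>F. f w * indicator {w} u) \<in> fun_space S"
    using insert.prems by (auto simp: fun_space_def indicator_def intro!: sum.neutral)
  have "\<forall>f\<in>fun_space S. \<forall>g\<in>fun_space S. A (\<lambda>u. f u + g u) = (\<lambda>v. A f v + A g v)"
    using A by (simp add: linear_op_def)
  from bspec[OF bspec[OF this s1] s2]
  have "A (\<lambda>u. f w * indicator {w} u + (\<Sum>w\<in>F. f w * indicator {w} u)) =
        (\<lambda>v. A (\<lambda>u. f w * indicator {w} u) v + A (\<lambda>u. \<Sum>w\<in>F. f w * indicator {w} u) v)"
    .
  then show ?case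
    unfolding sum.insert[OF insert.hyps(1,2)] using insert.IH insert.prems by (simp only: sc) simp
qed

lemma linear_op_expansion:
  assumes A: "linear_op S T A" and "finite S" "f \<in> fun_space S"
  shows "A f = (\<lambda>v. \<Sum>w\<in>S. f w * A (indicator {w}) v)"
proof -
  have "f = (\<lambda>u. \<Sum>w\<in>S. f w * indicator {w} u)"
  proof
    fix u
    have "(\<Sum>w\<in>S. f w * indicator {w} u) = (\<Sum>w\<in>S. if w = u then f w else 0)"
      by (rule sum.cong) (auto simp: indicator_def)
    then show "f u = (\<Sum>w\<in>S. f w * indicator {w} u)"
      using assms by (simp add: fun_space_def)
  qed
  then show ?thesis using linear_op_expansion_aux[OF A \<open>finite S\<close> subset_refl, of f] by simp
qed

lemma is_adjoint_on_adjoint_on: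
  assumes A: "linear_op S T A" and S: "finite S"
  shows "is_adjoint_on S T A (adjoint_on S T A)"
proof -
  define B where "B = (\<lambda>g u. if u \<in> S then cinner_on T (A (indicator {u})) g else 0)"
  have "linear_op T S B"
    by (auto simp: linear_op_def B_def fun_space_def cinner_on_def fun_eq_iff
        algebra_simps sum.distrib sum_distrib_left)
  moreover have "cinner_on T (A f) g = cinner_on S f (B g)" if f: "f \<in> fun_space S" for f g
  proof -
    have "cinner_on T (A f) g = (\<Sum>v\<in>T. \<Sum>w\<in>S. cnj (f w) * (cnj (A (indicator {w}) v) * g v))"
      unfolding cinner_on_def
      by (subst linear_op_expansion[OF A S f]) (simp add: sum_distrib_right mult.assoc)
    also have "\<dots> = (\<Sum>w\<in>S. \<Sum>v\<in>T. cnj (f w) * (cnj (A (indicator {w}) v) * g v))"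
      by (rule sum.swap)
    also have "\<dots> = cinner_on S f (B g)"
      by (simp add: cinner_on_def B_def sum_distrib_left)
    finally show ?thesis .
  qed
  ultimately have "is_adjoint_on S T A B" by (simp add: is_adjoint_on_def)
  then show ?thesis unfolding adjoint_on_def by (rule someI[where P = "is_adjoint_on S T A"])
qed

lemma is_adjoint_on_unique:
  assumes "is_adjoint_on S T A B" "is_adjoint_on S T A B'" "finite S" "g \<in> fun_space T"
  shows "B g = B' g"
proof
  fix u
  show "B g u = B' g u"
  proof (cases "u \<in> S")
    case True
    then have "cinner_on S (indicator {u}) (B g) = cinner_on S (indicator {u}) (B' g)"
      using assms indicator_in_fun_space[OF True] unfolding is_adjoint_on_def by metis
    then show ?thesis using True assms(3) by (simp add: cinner_on_indicator)
  next
    case False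
    then show ?thesis
      using assms unfolding is_adjoint_on_def linear_op_def fun_space_def by auto
  qed
qed

end

theory Submission
  imports Defs
begin

text \<open>Unitarity of the amplitude says that the columns \<open>U\<^sub>n x\<^sub>n\<^sub>,\<^sub>j\<close> are unit vectors with entry sum \<open>1\<close>;
  they are orthogonal because a vertex has only one parent. Hence \<open>U\<^sub>n\<^sup>* U\<^sub>n = 1\<close> on the basis
  vectors and \<open>U\<^sub>n\<^sup>* 1\<^bsub>n+1\<^esub> = 1\<^sub>n\<close>. Cyclicity of the trace and moving \<open>U\<^sub>n\<close> across the inner product
  give both claims.\<close>

section \<open>Linear operators, adjoints and the trace on finite function spaces\<close>

lemma linear_op_closed: "linear_op S T A \<Longrightarrow> f \<in> fun_space S \<Longrightarrow> A f \<in> fun_space T"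
  by (simp add: linear_op_def)

lemma linear_op_basis_closed: "linear_op S T A \<Longrightarrow> u \<in> S \<Longrightarrow> A (indicator {u}) \<in> fun_space T"
  by (rule linear_op_closed[OF _ indicator_in_fun_space])

lemma indicator_self_in_fun_space: "indicator S \<in> fun_space S"
  by (simp add: fun_space_def)

lemma linear_op_comp:
  assumes A: "linear_op R S A" and B: "linear_op S T B"
  shows "linear_op R T (B \<circ> A)"
proof -
  have "B (A (\<lambda>u. f u + g u)) = (\<lambda>v. B (A f) v + B (A g) v)"
    if "f \<in> fun_space R" "g \<in> fun_space R" for f g
  proof -
    have "A (\<lambda>u. f u + g u) = (\<lambda>v. A f v + A g v)"
      using A that unfolding linear_op_def by blast
    then show ?thesis
      using B linear_op_closed[OF A] that unfolding linear_op_def by metis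
  qed
  moreover have "B (A (\<lambda>u. c * f u)) = (\<lambda>v. c * B (A f) v)" if "f \<in> fun_space R" for c f
  proof -
    have "A (\<lambda>u. c * f u) = (\<lambda>v. c * A f v)"
      using A that unfolding linear_op_def by blast
    then show ?thesis
      using B linear_op_closed[OF A that] unfolding linear_op_def by metis
  qed
  ultimately show ?thesis
    using linear_op_closed[OF A] linear_op_closed[OF B]
    unfolding linear_op_def[of R T] comp_apply by blast
qed

lemma cinner_on_cnj: "cnj (cinner_on S f g) = cinner_on S g f"
  by (simp add: cinner_on_def mult.commute)

lemma is_adjoint_on_right:
  assumes "is_adjoint_on S T A B" "f \<in> fun_space S" "g \<in> fun_space T"
  shows "cinner_on T g (A f) = cinner_on S (B g) f"
  using assms unfolding is_adjoint_on_def by (metis cinner_on_cnj)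

text \<open>Pairing with a basis vector isolates a single entry, so the adjoint can be computed from
  the columns of \<open>A\<close>.\<close>

lemma is_adjoint_on_apply:
  assumes "is_adjoint_on S T A B" "finite S" "u \<in> S" "g \<in> fun_space T"
  shows "B g u = cinner_on T (A (indicator {u})) g"
  using assms indicator_in_fun_space[of u S]
  unfolding is_adjoint_on_def by (simp add: cinner_on_indicator)

text \<open>Expanding in basis vectors turns both traces into the same double sum of matrix entries.
  The two spaces may differ in dimension, as \<open>A\<close> moves between levels of different
  size.\<close>

lemma trace_op_commute:
  assumes A: "linear_op S T A" and M: "linear_op T S M" and S: "finite S" and T: "finite T"
  shows "trace_op T (A \<circ> M) = trace_op S (M \<circ> A)"
proof -
  have "trace_op T (A \<circ> M) = (\<Sum>v\<in>T. A (M (indicator {v})) v)"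
    by (simp add: trace_op_def cinner_on_indicator T)
  also have "\<dots> = (\<Sum>v\<in>T. \<Sum>w\<in>S. M (indicator {v}) w * A (indicator {w}) v)"
    by (intro sum.cong refl) (simp only: linear_op_expansion[OF A S linear_op_basis_closed[OF M]])
  also have "\<dots> = (\<Sum>w\<in>S. \<Sum>v\<in>T. A (indicator {w}) v * M (indicator {v}) w)"
    by (subst sum.swap) (simp add: mult.commute)
  also have "\<dots> = (\<Sum>w\<in>S. M (A (indicator {w})) w)"
    by (intro sum.cong refl) (simp only: linear_op_expansion[OF M T linear_op_basis_closed[OF A]])
  also have "\<dots> = trace_op S (M \<circ> A)"
    by (simp add: trace_op_def cinner_on_indicator S)
  finally show ?thesis .
qed

section \<open>Conjugation of states by an isometry\<close>

definition orthonormal_columns ::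
    "'p set \<Rightarrow> 'q set \<Rightarrow> (('p \<Rightarrow> complex) \<Rightarrow> ('q \<Rightarrow> complex)) \<Rightarrow> bool" where
  "orthonormal_columns S T A \<longleftrightarrow> (\<forall>u\<in>S. \<forall>w\<in>S.
     cinner_on T (A (indicator {u})) (A (indicator {w})) = (if u = w then 1 else 0))"

text \<open>Positivity: moving \<open>A\<close> across the inner product turns the quadratic form at
  \<open>f\<close> into that of \<open>\<rho>\<close> at \<open>B f\<close>. Trace: cyclicity brings
  \<open>B\<close> next to \<open>A\<close>, where they cancel on basis vectors.\<close>

lemma state_on_conj:
  assumes A: "linear_op S T A" and adj: "is_adjoint_on S T A B"
    and S: "finite S" and T: "finite T"
    and orth: "orthonormal_columns S T A"
    and \<rho>: "state_on S \<rho>"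
  shows "state_on T (A \<circ> \<rho> \<circ> B)"
proof -
  have B: "linear_op T S B" using adj by (simp add: is_adjoint_on_def)
  have pos: "positive_op S \<rho>" and tr: "trace_op S \<rho> = 1" using \<rho> by (auto simp: state_on_def)
  then have lin: "linear_op S S \<rho>" by (simp add: positive_op_def)
  have "cinner_on T f ((A \<circ> \<rho> \<circ> B) f) = cinner_on S (B f) (\<rho> (B f))" if "f \<in> fun_space T" for f
    using that adj lin B by (simp add: is_adjoint_on_right linear_op_closed)
  then have "positive_op T (A \<circ> \<rho> \<circ> B)"
    using pos lin A B linear_op_closed[OF B]
    by (simp add: positive_op_def linear_op_comp[OF B linear_op_comp[OF lin A]])
  moreover have "trace_op T (A \<circ> \<rho> \<circ> B) = 1"
  proof -
    \<comment> \<open>For \<open>w\<close> in \<open>S\<close>, the entry of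
      \<open>B (A (indicator {u}))\<close> at \<open>w\<close> is the inner product of columns
      \<open>w\<close> and \<open>u\<close>; outside \<open>S\<close> it vanishes because
      \<open>B\<close> maps into \<open>fun_space S\<close>.\<close>
    have id: "B (A (indicator {u})) = indicator {u}" if u: "u \<in> S" for u
    proof
      fix w
      have Au: "A (indicator {u}) \<in> fun_space T"
        using A u by (rule linear_op_basis_closed)
      show "B (A (indicator {u})) w = indicator {u} w"
      proof (cases "w \<in> S")
        case True
        then show ?thesis
          using orth u is_adjoint_on_apply[OF adj S True Au]
          by (auto simp: orthonormal_columns_def)
      next
        case False
        then show ?thesis using linear_op_closed[OF B Au] u
          by (auto simp: fun_space_def indicator_def)
      qed
    qed
    have "trace_op T (A \<circ> \<rho> \<circ> B) = trace_op S (\<rho> \<circ> B \<circ> A)"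
      \<comment> \<open>Cyclicity is applied with \<open>\<rho> \<circ> B\<close> as the second
        factor.\<close>
      using trace_op_commute[OF A linear_op_comp[OF B lin] S T] by (simp add: comp_assoc)
    also have "\<dots> = trace_op S \<rho>" by (simp add: trace_op_def id)
    finally show ?thesis using tr by simp
  qed
  ultimately show ?thesis by (simp add: state_on_def)
qed

text \<open>Unit column sums make \<open>B\<close> send the constant function 1 to the constant
  function 1, so the stochastic condition on \<open>T\<close> pulls back to the one on
  \<open>S\<close>.\<close>

lemma stochastic_state_on_conj:
  assumes A: "linear_op S T A" and adj: "is_adjoint_on S T A B"
    and S: "finite S" and T: "finite T"
    and orth: "orthonormal_columns S T A"
    and sum1: "\<And>u. u \<in> S \<Longrightarrow> (\<Sum>v\<in>T. A (indicator {u}) v) = 1"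
    and \<rho>: "stochastic_state_on S \<rho>"
  shows "stochastic_state_on T (A \<circ> \<rho> \<circ> B)"
proof -
  have st: "state_on S \<rho>" and one: "cinner_on S (\<rho> (indicator S)) (indicator S) = 1"
    using \<rho> by (auto simp: stochastic_state_on_def)
  have lin: "linear_op S S \<rho>" using st by (simp add: state_on_def positive_op_def)
  have B: "linear_op T S B" using adj by (simp add: is_adjoint_on_def)
  have "B (indicator T) = indicator S"
  proof
    fix u
    show "B (indicator T) u = indicator S u"
    proof (cases "u \<in> S")
      case True
      \<comment> \<open>The conjugate comes from the inner product being conjugate-linear in its
        first argument; it is harmless since the column sum is 1.\<close>
      have "B (indicator T) u = cnj (\<Sum>v\<in>T. A (indicator {u}) v)"
        by (simp add: is_adjoint_on_apply[OF adj S True indicator_self_in_fun_space] cinner_on_def)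
      then show ?thesis using True by (simp add: sum1)
    next
      case False
      then show ?thesis using linear_op_closed[OF B indicator_self_in_fun_space]
        by (auto simp: fun_space_def)
    qed
  qed
  then have "cinner_on T ((A \<circ> \<rho> \<circ> B) (indicator T)) (indicator T) =
      cinner_on S (\<rho> (indicator S)) (indicator S)"
    using adj linear_op_closed[OF lin indicator_self_in_fun_space]
    by (simp add: is_adjoint_on_def indicator_self_in_fun_space)
  with one show ?thesis
    using state_on_conj[OF A adj S T orth st] by (simp add: stochastic_state_on_def)
qed

section \<open>Indices and parents in the tree\<close>

lemma labelling_eq_iff:
  assumes "poset_labelling x" "m \<ge> 1" "n \<ge> 1" "i < 4 ^ (m - 1)" "j < 4 ^ (n - 1)"
  shows "x m i = x n j \<longleftrightarrow> m = n \<and> i = j"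
  using inj_onD[OF assms(1)[unfolded poset_labelling_def], of "(m, i)" "(n, j)"] assms(2-)
  by auto

text \<open>The bound \<open>4 ^ n\<close> is the size of level \<open>n + 1\<close>. At
  \<open>n = 0\<close> the truncated exponent \<open>n - 1\<close> would make the claim
  false.\<close>

lemma child_index_less:
  assumes "n \<ge> 1" "j < 4 ^ (n - 1)" "k < 4"
  shows "4 * j + k < (4::nat) ^ n"
  using assms by (cases n) auto

lemma offspring_labelled_iff:
  assumes "poset_labelling x" "n \<ge> 1" "j < 4 ^ (n - 1)" "i < 4 ^ n"
  shows "offspring x (x n j) (x (n + 1) i) \<longleftrightarrow> i div 4 = j"
proof
  assume "offspring x (x n j) (x (n + 1) i)"
  then obtain m l k where m: "m \<ge> 1" "l < 4 ^ (m - 1)" "k < 4"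
    "x n j = x m l" "x (n + 1) i = x (m + 1) (4 * l + k)"
    unfolding offspring_def by blast
  have "n = m" "j = l"
    using labelling_eq_iff[OF assms(1,2) m(1) assms(3) m(2)] m(4) by blast+
  then have "x (n + 1) i = x (n + 1) (4 * j + k)" using m(5) by simp
  then have "i = 4 * j + k"
    using labelling_eq_iff[OF assms(1), of "n + 1" "n + 1" i "4 * j + k"] assms(4)
      child_index_less[OF assms(2,3) m(3)] by auto
  then show "i div 4 = j" using m by simp
next
  assume "i div 4 = j"
  \<comment> \<open>Division with remainder supplies the child number \<open>k\<close> as
    \<open>i mod 4\<close>.\<close>
  then have "i = 4 * j + i mod 4" "i mod 4 < 4" by auto
  then show "offspring x (x n j) (x (n + 1) i)"
    unfolding offspring_def using assms(2,3) by metis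
qed

lemma offspring_level:
  assumes "poset_labelling x" "n \<ge> 1" "u \<in> level x n" "offspring x u v"
  shows "v \<in> level x (n + 1)"
proof -
  obtain j where j: "j < 4 ^ (n - 1)" "u = x n j" using assms by (auto simp: level_def)
  obtain m l k where m: "m \<ge> 1" "l < 4 ^ (m - 1)" "k < 4" "u = x m l"
    "v = x (m + 1) (4 * l + k)"
    using assms unfolding offspring_def by blast
  have "x n j = x m l" using j(2) m(4) by simp
  then have "n = m"
    using labelling_eq_iff[OF assms(1,2) m(1) j(1) m(2)] by blast
  then show ?thesis
    using m(5) child_index_less[OF m(1-3)] by (auto simp: level_def)
qed

text \<open>The labelling recovers level and index from a vertex, and \<open>4 * l + k\<close> with
  \<open>k < 4\<close> determines \<open>l\<close>. This is what gives distinct columns disjoint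
  supports.\<close>

lemma offspring_parent_unique:
  assumes "poset_labelling x" "offspring x u v" "offspring x w v"
  shows "u = w"
proof -
  obtain m l k where m: "m \<ge> 1" "l < 4 ^ (m - 1)" "k < 4" "u = x m l"
    "v = x (m + 1) (4 * l + k)"
    using assms unfolding offspring_def by blast
  obtain n j i where n: "n \<ge> 1" "j < 4 ^ (n - 1)" "i < 4" "w = x n j"
    "v = x (n + 1) (4 * j + i)"
    using assms unfolding offspring_def by blast
  have "m = n \<and> 4 * l + k = 4 * j + i"
    using labelling_eq_iff[OF assms(1), of "m + 1" "n + 1" "4 * l + k" "4 * j + i"]
      child_index_less[OF m(1-3)] child_index_less[OF n(1-3)] trans[OF m(5)[symmetric] n(5)]
    by auto
  then have "m = n" "l = j" using m(3) n(3) by presburger+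
  then show ?thesis using m(4) n(4) by simp
qed

section \<open>Columns of a unitary transition amplitude\<close>

lemma level_subset: "n \<ge> 1 \<Longrightarrow> level x n \<subseteq> all_posets x"
  by (auto simp: all_posets_def)

lemma finite_level: "finite (level x n)"
  by (simp add: level_def)

lemma amplitude_eq_0:
  assumes "unitary_transition_amplitude x a" "u \<in> all_posets x" "v \<in> all_posets x"
    "\<not> offspring x u v"
  shows "a u v = 0"
  using assms by (simp add: unitary_transition_amplitude_def)

text \<open>From a vertex of level \<open>n\<close> the amplitude vanishes off level
  \<open>n + 1\<close>, so the sums over the infinite tree reduce to finite ones.\<close>

lemma amplitude_level_sums:
  assumes x: "poset_labelling x" and a: "unitary_transition_amplitude x a"
    and n: "n \<ge> 1" and u: "u \<in> level x n"
  shows "(\<Sum>v\<in>level x (n + 1). a u v) = 1"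
    and "(\<Sum>v\<in>level x (n + 1). (cmod (a u v))\<^sup>2) = 1"
proof -
  have uP: "u \<in> all_posets x" using u level_subset[OF n, of x] by blast
  have sub: "level x (n + 1) \<subseteq> all_posets x" by (simp add: level_subset)
  have zero: "a u v = 0" if "v \<in> all_posets x - level x (n + 1)" for v
    using that offspring_level[OF x n u] amplitude_eq_0[OF a uP] by blast
  have "(a u has_sum 1) (level x (n + 1)) \<longleftrightarrow> (a u has_sum 1) (all_posets x)"
    using sub zero by (intro has_sum_cong_neutral) auto
  then have "(a u has_sum 1) (level x (n + 1))"
    using a uP by (simp add: unitary_transition_amplitude_def)
  then show "(\<Sum>v\<in>level x (n + 1). a u v) = 1"
    by (simp add: has_sum_finite_iff[OF finite_level])
  have "((\<lambda>v. (cmod (a u v))\<^sup>2) has_sum 1) (level x (n + 1)) \<longleftrightarrow>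
      ((\<lambda>v. (cmod (a u v))\<^sup>2) has_sum 1) (all_posets x)"
    using sub zero by (intro has_sum_cong_neutral) auto
  then have "((\<lambda>v. (cmod (a u v))\<^sup>2) has_sum 1) (level x (n + 1))"
    using a uP by (simp add: unitary_transition_amplitude_def)
  then show "(\<Sum>v\<in>level x (n + 1). (cmod (a u v))\<^sup>2) = 1"
    by (simp add: has_sum_finite_iff[OF finite_level])
qed

text \<open>At most one of the four indicators is nonzero at \<open>v\<close>. This identifies the
  columns prescribed by the coupling constants with the amplitude itself.\<close>

lemma coupling_column:
  assumes x: "poset_labelling x" and a: "unitary_transition_amplitude x a"
    and n: "n \<ge> 1" and j: "j < 4 ^ (n - 1)" and v: "v \<in> level x (n + 1)"
  shows "(\<Sum>k<4. coupling_constant x a n j k * indicator {x (n + 1) (4 * j + k)} v) = a (x n j) v"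
proof -
  obtain i where i: "i < 4 ^ n" and vi: "v = x (n + 1) i" using v by (auto simp: level_def)
  have xP: "x n j \<in> all_posets x" using n j by (auto simp: all_posets_def level_def)
  have vP: "v \<in> all_posets x" using v level_subset[of "n + 1" x] by auto
  have eq: "v = x (n + 1) (4 * j + k) \<longleftrightarrow> i = 4 * j + k" if "k < 4" for k
    using labelling_eq_iff[OF x, of "n + 1" "n + 1" i "4 * j + k"] i
      child_index_less[OF n j that] unfolding vi by simp
  have "(\<Sum>k<4. coupling_constant x a n j k * indicator {x (n + 1) (4 * j + k)} v) =
      (\<Sum>k<4. if i = 4 * j + k then a (x n j) v else 0)"
    using eq by (intro sum.cong) (auto simp: indicator_def coupling_constant_def)
  also have "\<dots> = a (x n j) v"
  proof (cases "i div 4 = j")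
    case True
    then have "i = 4 * j + k \<longleftrightarrow> k = i mod 4" for k by presburger
    then show ?thesis by simp
  next
    case False
    \<comment> \<open>Here \<open>v\<close> is not a child of \<open>x n j\<close>, so both sides
      are zero.\<close>
    then have "a (x n j) v = 0"
      using offspring_labelled_iff[OF x n j i] vi xP vP by (intro amplitude_eq_0[OF a]) auto
    then show ?thesis by (auto intro: sum.neutral)
  qed
  finally show ?thesis .
qed

text \<open>Diagonal inner products are the normalised sums of squared moduli; off-diagonal ones
  vanish term by term, since no \<open>v\<close> has two parents.\<close>

lemma amplitude_columns_orthonormal:
  assumes x: "poset_labelling x" and a: "unitary_transition_amplitude x a" and n: "n \<ge> 1"
    and col: "\<And>u v. u \<in> level x n \<Longrightarrow> v \<in> level x (n + 1) \<Longrightarrow> A (indicator {u}) v = a u v"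
  shows "orthonormal_columns (level x n) (level x (n + 1)) A"
  unfolding orthonormal_columns_def
proof (intro ballI)
  fix u w assume u: "u \<in> level x n" and w: "w \<in> level x n"
  have eq: "cinner_on (level x (n + 1)) (A (indicator {u})) (A (indicator {w})) =
      (\<Sum>v\<in>level x (n + 1). cnj (a u v) * a w v)"
    by (simp add: cinner_on_def col u w)
  show "cinner_on (level x (n + 1)) (A (indicator {u})) (A (indicator {w})) =
      (if u = w then 1 else 0)"
  proof (cases "u = w")
    case True
    have "(\<Sum>v\<in>level x (n + 1). cnj (a u v) * a u v) =
        of_real (\<Sum>v\<in>level x (n + 1). (cmod (a u v))\<^sup>2)"
      unfolding of_real_sum by (intro sum.cong refl) (metis complex_norm_square mult.commute)
    then show ?thesis using eq True by (simp only: amplitude_level_sums(2)[OF x a n w]) simp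
  next
    case False
    have "cnj (a u v) * a w v = 0" if "v \<in> level x (n + 1)" for v
    proof -
      have "u \<in> all_posets x" "w \<in> all_posets x" "v \<in> all_posets x"
        using that u w level_subset[OF n, of x] level_subset[of "n + 1" x] by auto
      then have "a u v = 0 \<or> a w v = 0"
        using False offspring_parent_unique[OF x] amplitude_eq_0[OF a] by metis
      then show ?thesis by auto
    qed
    then have "(\<Sum>v\<in>level x (n + 1). cnj (a u v) * a w v) = 0" by (intro sum.neutral) blast
    then show ?thesis using eq False by simp
  qed
qed

theorem corollary3p2:
  fixes x :: "nat \<Rightarrow> nat \<Rightarrow> 'p"
    and a :: "'p \<Rightarrow> 'p \<Rightarrow> complex"
    and U :: "nat \<Rightarrow> ('p \<Rightarrow> complex) \<Rightarrow> ('p \<Rightarrow> complex)"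
  assumes "poset_labelling x"
    and "unitary_transition_amplitude x a"
    and "\<And>n. n \<ge> 1 \<Longrightarrow> linear_op (level x n) (level x (n + 1)) (U n)"
    and "\<And>n j. n \<ge> 1 \<Longrightarrow> j < 4 ^ (n - 1) \<Longrightarrow>
           U n (indicator {x n j}) =
             (\<lambda>v. \<Sum>k<4. coupling_constant x a n j k * indicator {x (n + 1) (4 * j + k)} v)"
  shows "\<forall>n\<ge>1.
    (\<forall>\<rho>. state_on (level x n) \<rho> \<longrightarrow>
       state_on (level x (n + 1)) (U n \<circ> \<rho> \<circ> adjoint_on (level x n) (level x (n + 1)) (U n))) \<and>
    (\<forall>\<rho>. stochastic_state_on (level x n) \<rho> \<longrightarrow>
       stochastic_state_on (level x (n + 1))
         (U n \<circ> \<rho> \<circ> adjoint_on (level x n) (level x (n + 1)) (U n)))"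
proof (intro allI impI)
  fix n :: nat assume n: "n \<ge> 1"
  let ?S = "level x n" and ?T = "level x (n + 1)"
  note A = assms(3)[OF n]
  \<comment> \<open>From here on \<open>U n\<close> is described by the amplitude on vertices
    instead of by coupling constants on indices.\<close>
  have col: "U n (indicator {u}) v = a u v" if "u \<in> ?S" "v \<in> ?T" for u v
    using that coupling_column[OF assms(1,2) n] assms(4)[OF n] by (auto simp: level_def)
  have orth: "orthonormal_columns ?S ?T (U n)"
    using assms(1,2) n col by (rule amplitude_columns_orthonormal)
  have sum1: "(\<Sum>v\<in>?T. U n (indicator {u}) v) = 1" if "u \<in> ?S" for u
    using amplitude_level_sums(1)[OF assms(1,2) n that] by (simp add: col that)
  \<comment> \<open>\<open>adjoint_on\<close> is a choice; its existence lemma turns it into an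
    actual adjoint, as the conjugation lemmas require.\<close>
  note adj = is_adjoint_on_adjoint_on[OF A finite_level]
  show "(\<forall>\<rho>. state_on ?S \<rho> \<longrightarrow> state_on ?T (U n \<circ> \<rho> \<circ> adjoint_on ?S ?T (U n))) \<and>
    (\<forall>\<rho>. stochastic_state_on ?S \<rho> \<longrightarrow>
       stochastic_state_on ?T (U n \<circ> \<rho> \<circ> adjoint_on ?S ?T (U n)))"
    using state_on_conj[OF A adj finite_level finite_level orth]
      stochastic_state_on_conj[OF A adj finite_level finite_level orth sum1] by blast
qed

end
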